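(* For all weak compositions $\nu=(\nu_1,\dots,\nu_n)$ of $m$, there is an invertible $\mathbb{Z}$-linear transformation from $\mathbb{R}^{m+n+1}$ to itself that takes $\mathcal{H}_\nu$ to the graphic hyperplane arrangement $\mathcal{A}_{G_\nu}$. Consequently, $\mathcal{L}(\mathcal{H}_\nu)\cong \Pi_{G_\nu}$.
   Context: A weak composition of $m$ is an ordered tuple $\nu=(\nu_1,\dots,\nu_n)$ of nonnegative integers with sum $m$ ($n\ge 1$). The homogenized $\nu$-arrangement $\mathcal{H}_\nu$ is the real hyperplane arrangement in $\mathbb{R}^{m+n+1}$, with coordinates $x_1,\dots,x_{n+1}$ and $y_i^{(\ell)}$ ($1\le i\le n$, $1\le \ell\le \nu_i$), given by $$\mathcal{H}_\nu=\{x_i-x_j=y_i^{(\ell)} \mid 1\le i<j\le n+1,\ 1\le \ell\le \nu_i\}.$$ $G_\nu$ is the bipartite graph on vertex set $C\sqcup R$, where $C=\{(2i-1)^{(\ell)} : 1\le i\le n,\ 1\le \ell\le \nu_i\}$ and $R=\{2,4,\dots,2n\}$, whose edges are $\{(2i-1)^{(\ell)},2j\}$ for all $1\le i,j\le n$ with $2i-1<2j$ and all $1\le \ell\le \nu_i$. For a finite graph $G$, the graphic hyperplane arrangement is $\mathcal{A}_G=\{x_a-x_b=0 \mid \{a,b\}\text{ an edge of }G\}$, with one coordinate per vertex. Since $G_\nu$ has $m+n$ vertices, $\mathcal{A}_{G_\nu}$ is regarded as an arrangement in $\mathbb{R}^{m+n+1}$ by adjoining one isolated vertex to $G_\nu$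 (i.e. one extra coordinate not occurring in any equation). An invertible $\mathbb{Z}$-linear transformation of $\mathbb{R}^{N}$ is a linear map whose matrix in the standard basis has integer entries and has an inverse with integer entries. It takes one arrangement to another if it maps the hyperplanes of the first bijectively onto the hyperplanes of the second. $\mathcal{L}(\mathcal{H})$ is the intersection poset of $\mathcal{H}$: all intersections of hyperplanes of $\mathcal{H}$ (including the whole space), ordered by reverse inclusion. The bond lattice $\Pi_G$ is the poset, ordered by refinement, of set partitions of the vertex set of $G$ each of whose blocks induces a connected subgraph of $G$. *)

theory Defs
  imports "Jordan_Normal_Form.Matrix" "Graph_Theory.Graph_Theory" "HOL-Library.Disjoint_Sets"
begin

text \<open>
  A tuple of length \<open>n\<close> is a function on \<open>nat\<close> of which only the values at \<open>1, \<dots>, n\<close> are used.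
\<close>

definition weak_composition :: "nat \<Rightarrow> nat \<Rightarrow> (nat \<Rightarrow> nat) \<Rightarrow> bool" where
  "weak_composition m n \<nu> \<longleftrightarrow> n \<ge> 1 \<and> (\<Sum>i = 1..n. \<nu> i) = m"

text \<open>
  The space \<open>\<real>\<^sup>N\<close> is \<^term>\<open>carrier_vec N :: real vec set\<close>, whose coordinates are numbered from
  \<open>0\<close>, and an arrangement is the set of its hyperplanes, each a set of points.  The labelled
  coordinates of the mathematical text are placed in a fixed order; families indexed by pairs
  \<open>(i, \<ell>)\<close> with \<open>1 \<le> i \<le> n\<close> and \<open>1 \<le> \<ell> \<le> \<nu>\<^sub>i\<close> are ordered lexicographically.
\<close>

definition lex_pos :: "(nat \<Rightarrow> nat) \<Rightarrow> nat \<Rightarrow> nat \<Rightarrow> nat" where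
  "lex_pos \<nu> i l = (\<Sum>k = 1..<i. \<nu> k) + (l - 1)"

datatype coord = X nat | Y nat nat

definition coords :: "nat \<Rightarrow> (nat \<Rightarrow> nat) \<Rightarrow> coord set" where
  "coords n \<nu> = {X i | i. 1 \<le> i \<and> i \<le> n + 1} \<union> {Y i l | i l. 1 \<le> i \<and> i \<le> n \<and> 1 \<le> l \<and> l \<le> \<nu> i}"

fun coord_pos :: "nat \<Rightarrow> (nat \<Rightarrow> nat) \<Rightarrow> coord \<Rightarrow> nat" where
  "coord_pos n \<nu> (X i) = i - 1"
| "coord_pos n \<nu> (Y i l) = (n + 1) + lex_pos \<nu> i l"

definition homogenized_arrangement :: "nat \<Rightarrow> nat \<Rightarrow> (nat \<Rightarrow> nat) \<Rightarrow> real vec set set" where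
  "homogenized_arrangement m n \<nu> =
     {{v \<in> carrier_vec (m + n + 1).
         v $ coord_pos n \<nu> (X i) - v $ coord_pos n \<nu> (X j) = v $ coord_pos n \<nu> (Y i l)}
      | i j l. 1 \<le> i \<and> i < j \<and> j \<le> n + 1 \<and> 1 \<le> l \<and> l \<le> \<nu> i}"


text \<open>
  Finite simple graphs are the symmetric loop-free pair digraphs of the library
  (locale \<^locale>\<open>pair_graph\<close>): an undirected edge is a pair of opposite arcs.

  \<open>Odd (2 * i - 1) l\<close> stands for the vertex \<open>(2i - 1)\<close> with superscript \<open>(l)\<close>, and
  \<open>Even (2 * j)\<close> for the vertex \<open>2j\<close>.
\<close>

datatype vertex = Odd nat nat | Even nat

definition G_nu :: "nat \<Rightarrow> (nat \<Rightarrow> nat) \<Rightarrow> vertex pair_pre_digraph" where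
  "G_nu n \<nu> =
     (let E = {(Odd (2 * i - 1) l, Even (2 * j)) | i j l.
                 1 \<le> i \<and> i \<le> n \<and> 1 \<le> j \<and> j \<le> n \<and> 2 * i - 1 < 2 * j \<and> 1 \<le> l \<and> l \<le> \<nu> i}
      in \<lparr> pverts = {Odd (2 * i - 1) l | i l. 1 \<le> i \<and> i \<le> n \<and> 1 \<le> l \<and> l \<le> \<nu> i}
                    \<union> {Even (2 * j) | j. 1 \<le> j \<and> j \<le> n},
           parcs = E \<union> E\<inverse> \<rparr>)"

definition adjoin_isolated_vertex :: "'a pair_pre_digraph \<Rightarrow> 'a option pair_pre_digraph" where
  "adjoin_isolated_vertex G =
     \<lparr> pverts = insert None (Some ` pverts G), parcs = map_prod Some Some ` parcs G \<rparr>"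

text \<open>The parameter \<open>p\<close> numbers the vertices of \<open>G\<close> by \<open>0, \<dots>, card (pverts G) - 1\<close>.\<close>

definition graphic_arrangement :: "('a \<Rightarrow> nat) \<Rightarrow> 'a pair_pre_digraph \<Rightarrow> real vec set set" where
  "graphic_arrangement p G =
     {{v \<in> carrier_vec (card (pverts G)). v $ p a - v $ p b = 0} | a b. (a, b) \<in> parcs G}"

fun vertex_pos :: "nat \<Rightarrow> nat \<Rightarrow> (nat \<Rightarrow> nat) \<Rightarrow> vertex option \<Rightarrow> nat" where
  "vertex_pos m n \<nu> (Some (Even b)) = b div 2 - 1"
| "vertex_pos m n \<nu> (Some (Odd a l)) = n + lex_pos \<nu> ((a + 1) div 2) l"
| "vertex_pos m n \<nu> None = m + n"


definition invertible_Z_linear :: "nat \<Rightarrow> (real vec \<Rightarrow> real vec) \<Rightarrow> bool" where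
  "invertible_Z_linear N f \<longleftrightarrow>
     (\<exists>A \<in> carrier_mat N N. elements_mat A \<subseteq> \<int> \<and>
        (\<forall>v \<in> carrier_vec N. f v = A *\<^sub>v v) \<and>
        (\<exists>B \<in> carrier_mat N N. elements_mat B \<subseteq> \<int> \<and> A * B = 1\<^sub>m N \<and> B * A = 1\<^sub>m N))"

definition takes_arrangement ::
  "(real vec \<Rightarrow> real vec) \<Rightarrow> real vec set set \<Rightarrow> real vec set set \<Rightarrow> bool" where
  "takes_arrangement f \<A> \<B> \<longleftrightarrow> bij_betw (\<lambda>h. f ` h) \<A> \<B>"


text \<open>The empty family \<open>\<F>\<close> contributes the whole space.\<close>

definition intersection_poset :: "nat \<Rightarrow> real vec set set \<Rightarrow> real vec set set" where
  "intersection_poset N \<A> = {carrier_vec N \<inter> \<Inter>\<F> | \<F>. \<F> \<subseteq> \<A>}"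

text \<open>The qualified name avoids topological connectedness.\<close>

definition bond_lattice :: "'a pair_pre_digraph \<Rightarrow> 'a set set set" where
  "bond_lattice G =
     {P. partition_on (pverts G) P \<and>
         (\<forall>W \<in> P. Digraph_Component.connected (with_proj G \<restriction> W))}"

definition order_isomorphic ::
  "'a set \<Rightarrow> ('a \<Rightarrow> 'a \<Rightarrow> bool) \<Rightarrow> 'b set \<Rightarrow> ('b \<Rightarrow> 'b \<Rightarrow> bool) \<Rightarrow> bool" where
  "order_isomorphic S r T s \<longleftrightarrow>
     (\<exists>\<phi>. bij_betw \<phi> S T \<and> (\<forall>x \<in> S. \<forall>y \<in> S. r x y \<longleftrightarrow> s (\<phi> x) (\<phi> y)))"


text \<open>The numberings of the coordinates and vertices are bijections, and \<open>G_nu\<close> is a simple graph.\<close>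

lemma bij_lex_pos:
  "bij_betw (\<lambda>(i, l). lex_pos \<nu> i l) (SIGMA i:{1..n}. {1..\<nu> i}) {..<(\<Sum>i = 1..n. \<nu> i)}"
proof (induction n)
  case 0
  then show ?case by (simp add: bij_betw_def)
next
  case (Suc n)
  let ?s = "\<Sum>i = 1..n. \<nu> i"
  have S: "(SIGMA i:{1..Suc n}. {1..\<nu> i}) = (SIGMA i:{1..n}. {1..\<nu> i}) \<union> {Suc n} \<times> {1..\<nu> (Suc n)}"
    by (auto simp: le_Suc_eq)
  have T: "{..<(\<Sum>i = 1..Suc n. \<nu> i)} = {..<?s} \<union> {?s..<?s + \<nu> (Suc n)}" by auto
  have *: "lex_pos \<nu> (Suc n) l = ?s + (l - 1)" for l
    by (simp add: lex_pos_def atLeastLessThanSuc_atLeastAtMost)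
  have "bij_betw (\<lambda>(i, l). lex_pos \<nu> i l) ({Suc n} \<times> {1..\<nu> (Suc n)}) {?s..<?s + \<nu> (Suc n)}"
    by (rule bij_betw_byWitness[where f' = "\<lambda>k. (Suc n, k - ?s + 1)"]) (auto simp: *)
  then show ?case unfolding S T by (rule bij_betw_combine[OF Suc]) auto
qed

lemma bij_coord_pos:
  assumes "weak_composition m n \<nu>"
  shows "bij_betw (coord_pos n \<nu>) (coords n \<nu>) {..<m + n + 1}"
proof -
  let ?P = "SIGMA i:{1..n}. {1..\<nu> i}"
  have m: "(\<Sum>i = 1..n. \<nu> i) = m" using assms by (simp add: weak_composition_def)
  have C: "coords n \<nu> = X ` {1..n + 1} \<union> (\<lambda>(i, l). Y i l) ` ?P"
    by (auto simp: coords_def image_iff)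
  have T: "{..<m + n + 1} = {..<n + 1} \<union> {n + 1..<m + n + 1}" by auto
  have 1: "bij_betw (coord_pos n \<nu>) (X ` {1..n + 1}) {..<n + 1}"
    by (rule bij_betw_byWitness[where f' = "\<lambda>k. X (k + 1)"]) auto
  have "bij_betw ((+) (n + 1) \<circ> (\<lambda>(i, l). lex_pos \<nu> i l)) ?P ((+) (n + 1) ` {..<m})"
    using bij_lex_pos[of \<nu> n] unfolding m
    by (rule bij_betw_trans) (simp add: bij_betw_def)
  also have "(+) (n + 1) ` {..<m} = {n + 1..<m + n + 1}"
    using image_add_atLeastLessThan[of "n + 1" 0 m] by (simp add: atLeast0LessThan add_ac)
  also have "(+) (n + 1) \<circ> (\<lambda>(i, l). lex_pos \<nu> i l) = coord_pos n \<nu> \<circ> (\<lambda>(i, l). Y i l)"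
    by auto
  finally have "bij_betw (coord_pos n \<nu> \<circ> (\<lambda>(i, l). Y i l)) ?P {n + 1..<m + n + 1}" .
  moreover have "inj_on (\<lambda>(i, l). Y i l) ?P" by (auto simp: inj_on_def)
  ultimately have 2: "bij_betw (coord_pos n \<nu>) ((\<lambda>(i, l). Y i l) ` ?P) {n + 1..<m + n + 1}"
    using bij_betw_comp_iff bij_betw_imageI by blast
  show ?thesis unfolding C T by (rule bij_betw_combine[OF 1 2]) auto
qed

lemma bij_vertex_pos:
  assumes "weak_composition m n \<nu>"
  shows "bij_betw (vertex_pos m n \<nu>) (pverts (adjoin_isolated_vertex (G_nu n \<nu>))) {..<m + n + 1}"
proof -
  let ?P = "SIGMA i:{1..n}. {1..\<nu> i}" and ?o = "\<lambda>(i, l). Some (Odd (2 * i - 1) l)"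
  have m: "(\<Sum>i = 1..n. \<nu> i) = m" using assms by (simp add: weak_composition_def)
  have C: "pverts (adjoin_isolated_vertex (G_nu n \<nu>)) =
      ((\<lambda>j. Some (Even (2 * j))) ` {1..n} \<union> ?o ` ?P) \<union> {None}"
    unfolding adjoin_isolated_vertex_def G_nu_def Let_def by (auto simp: image_iff)
  have T: "{..<m + n + 1} = ({..<n} \<union> {n..<m + n}) \<union> {m + n}" by auto
  have 1: "bij_betw (vertex_pos m n \<nu>) ((\<lambda>j. Some (Even (2 * j))) ` {1..n}) {..<n}"
    by (rule bij_betw_byWitness[where f' = "\<lambda>k. Some (Even (2 * (k + 1)))"])
      (auto intro!: image_eqI[where x = "_ + 1"])
  have "bij_betw ((+) n \<circ> (\<lambda>(i, l). lex_pos \<nu> i l)) ?P ((+) n ` {..<m})"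
    using bij_lex_pos[of \<nu> n] unfolding m
    by (rule bij_betw_trans) (simp add: bij_betw_def)
  also have "(+) n ` {..<m} = {n..<m + n}"
    using image_add_atLeastLessThan[of n 0 m] by (simp add: atLeast0LessThan add_ac)
  finally have "bij_betw ((+) n \<circ> (\<lambda>(i, l). lex_pos \<nu> i l)) ?P {n..<m + n}" .
  moreover have "((+) n \<circ> (\<lambda>(i, l). lex_pos \<nu> i l)) x = (vertex_pos m n \<nu> \<circ> ?o) x" if "x \<in> ?P" for x
    using that by auto
  ultimately have "bij_betw (vertex_pos m n \<nu> \<circ> ?o) ?P {n..<m + n}"
    using bij_betw_cong by blast
  moreover have "inj_on ?o ?P" by (auto simp: inj_on_def)
  ultimately have 2: "bij_betw (vertex_pos m n \<nu>) (?o ` ?P) {n..<m + n}"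
    using bij_betw_comp_iff bij_betw_imageI by blast
  have 3: "bij_betw (vertex_pos m n \<nu>) {None} {m + n}" by (simp add: bij_betw_def)
  show ?thesis unfolding C T
    by (rule bij_betw_combine[OF bij_betw_combine[OF 1 2] 3]) auto
qed

lemma card_pverts_adjoin_G_nu:
  "weak_composition m n \<nu> \<Longrightarrow> card (pverts (adjoin_isolated_vertex (G_nu n \<nu>))) = m + n + 1"
  using bij_betw_same_card[OF bij_vertex_pos] by simp

lemma pair_graph_G_nu: "pair_graph (G_nu n \<nu>)"
proof -
  have V: "finite (pverts (G_nu n \<nu>))"
  proof -
    have "pverts (G_nu n \<nu>) = (\<lambda>(i, l). Odd (2 * i - 1) l) ` (SIGMA i:{1..n}. {1..\<nu> i})
        \<union> (\<lambda>j. Even (2 * j)) ` {1..n}"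
      unfolding G_nu_def Let_def by (auto simp: image_iff)
    then show ?thesis by simp
  qed
  have A: "parcs (G_nu n \<nu>) \<subseteq> pverts (G_nu n \<nu>) \<times> pverts (G_nu n \<nu>)"
    by (auto simp: G_nu_def Let_def)
  show ?thesis
  proof
    show "finite (parcs (G_nu n \<nu>))" using A V finite_subset by blast
    show "symmetric (with_proj (G_nu n \<nu>))"
      by (auto simp: G_nu_def Let_def symmetric_def sym_def)
  qed (use A V in \<open>auto simp: G_nu_def Let_def\<close>)
qed

end

theory Submission
  imports Defs
begin

text \<open>
  The equation \<open>x\<^sub>i - x\<^sub>j = y\<^sub>i\<^sup>l\<close> says that \<open>x\<^sub>i - y\<^sub>i\<^sup>l\<close> and \<open>x\<^sub>j\<close> agree.  Giving the vertex \<open>(2i - 1)\<^sup>l\<close>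
  the coordinate \<open>x\<^sub>i - y\<^sub>i\<^sup>l\<close> and the vertex \<open>2j\<close> the coordinate \<open>x\<close> of index \<open>j + 1\<close>, it becomes the
  equation of an edge of the graph, and the condition \<open>i < j + 1\<close> on the indices of an equation is the
  condition \<open>2i - 1 < 2j\<close> on an edge.  These \<open>m + n\<close> linear forms do not determine \<open>x\<^sub>1\<close>, as only
  the \<open>x\<close> of index at least 2 occur alone; the isolated vertex takes \<open>x\<^sub>1\<close> as its coordinate.
  Then every \<open>x\<^sub>i\<close> is a new coordinate, and \<open>y\<^sub>i\<^sup>l\<close> is \<open>x\<^sub>i\<close> minus a new coordinate, so that the inverse
  is integral as well (\<open>exists_coordinate_change\<close>).

  A linear bijection carries intersections to intersections
  (\<open>order_isomorphic_intersection_poset\<close>), so it remains to know the intersection poset of a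
  graphic arrangement (\<open>bond_lattice_iso_intersection_poset\<close>).  A partition of the vertices
  defines the subspace of the points that are constant on each block.  Indicator vectors of
  blocks show that this subspace determines the partition and turns refinement into reverse
  inclusion, for arbitrary partitions (\<open>block_flat_subset_iff\<close>).  Connectedness of the blocks
  enters in matching these subspaces with the flats: equality along the edges inside a connected
  block spreads to the whole block (\<open>block_flat_bond\<close>), and conversely the equations of a set of
  edges hold exactly on the vectors constant on the components of those edges
  (\<open>flat_eq_block_flat\<close>).
\<close>

section \<open>Isomorphisms of ordered sets\<close>

lemma order_isomorphic_trans:
  assumes "order_isomorphic S r T s" "order_isomorphic T s U t"
  shows "order_isomorphic S r U t"
proof -
  obtain \<phi> where \<phi>: "bij_betw \<phi> S T" "\<forall>x \<in> S. \<forall>y \<in> S. r x y \<longleftrightarrow> s (\<phi> x) (\<phi> y)"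
    using assms(1) by (auto simp: order_isomorphic_def)
  obtain \<psi> where \<psi>: "bij_betw \<psi> T U" "\<forall>x \<in> T. \<forall>y \<in> T. s x y \<longleftrightarrow> t (\<psi> x) (\<psi> y)"
    using assms(2) by (auto simp: order_isomorphic_def)
  have "bij_betw (\<psi> \<circ> \<phi>) S U" using \<phi>(1) \<psi>(1) by (rule bij_betw_trans)
  moreover have "r x y \<longleftrightarrow> t ((\<psi> \<circ> \<phi>) x) ((\<psi> \<circ> \<phi>) y)" if "x \<in> S" "y \<in> S" for x y
    using that \<phi> \<psi>(2) by (auto simp: bij_betw_apply)
  ultimately show ?thesis unfolding order_isomorphic_def by blast
qed

lemma order_isomorphic_sym:
  assumes "order_isomorphic S r T s"
  shows "order_isomorphic T s S r"
proof -
  obtain \<phi> where \<phi>: "bij_betw \<phi> S T" "\<forall>x \<in> S. \<forall>y \<in> S. r x y \<longleftrightarrow> s (\<phi> x) (\<phi> y)"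
    using assms by (auto simp: order_isomorphic_def)
  have "s x y \<longleftrightarrow> r (inv_into S \<phi> x) (inv_into S \<phi> y)" if "x \<in> T" "y \<in> T" for x y
  proof -
    have "inv_into S \<phi> x \<in> S" "inv_into S \<phi> y \<in> S"
      using that \<phi>(1) by (auto simp: bij_betw_def intro: inv_into_into)
    then show ?thesis using that \<phi> by (simp add: bij_betw_inv_into_right)
  qed
  then show ?thesis
    unfolding order_isomorphic_def using bij_betw_inv_into[OF \<phi>(1)] by blast
qed

section \<open>Integral transformations of arrangements\<close>

text \<open>
  The columns of a matrix are its values on unit vectors, so being inverse as maps gives the
  matrix equations.  Inverses can thus be checked one coordinate at a time.
\<close>

lemma invertible_Z_linearI:
  assumes A: "A \<in> carrier_mat N N" "elements_mat A \<subseteq> \<int>"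
    and B: "B \<in> carrier_mat N N" "elements_mat B \<subseteq> \<int>"
    and BA: "\<And>v. v \<in> carrier_vec N \<Longrightarrow> B *\<^sub>v (A *\<^sub>v v) = v"
    and AB: "\<And>v. v \<in> carrier_vec N \<Longrightarrow> A *\<^sub>v (B *\<^sub>v v) = v"
  shows "invertible_Z_linear N (\<lambda>v. A *\<^sub>v v)"
proof -
  have id: "C * D = 1\<^sub>m N"
    if C: "C \<in> carrier_mat N N" and D: "D \<in> carrier_mat N N"
      and CD: "\<And>v. v \<in> carrier_vec N \<Longrightarrow> C *\<^sub>v (D *\<^sub>v v) = (v :: real vec)" for C D
  proof (rule eq_matI)
    fix i j assume ij: "i < dim_row (1\<^sub>m N :: real mat)" "j < dim_col (1\<^sub>m N :: real mat)"
    have "col (C * D) j = C *\<^sub>v col D j" using C D ij by auto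
    also have "col D j = D *\<^sub>v unit_vec N j"
      using D ij by (intro eq_vecI) auto
    finally have "col (C * D) j = unit_vec N j" using CD by simp
    then have "col (C * D) j $ i = unit_vec N j $ i" by simp
    then show "(C * D) $$ (i, j) = 1\<^sub>m N $$ (i, j)" using C D ij by auto
  qed (use C D in auto)
  show ?thesis
    unfolding invertible_Z_linear_def using A B id[OF A(1) B(1) AB] id[OF B(1) A(1) BA] by blast
qed

text \<open>
  In both directions of the change of coordinates every new coordinate is an old one or the
  difference of two old ones: row \<open>r\<close> produces coordinate \<open>s r\<close>, minus the coordinate in \<open>t r\<close> if
  there is one.
\<close>

definition diff_mat :: "nat \<Rightarrow> (nat \<Rightarrow> nat) \<Rightarrow> (nat \<Rightarrow> nat option) \<Rightarrow> real mat" where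
  "diff_mat N s t = mat N N (\<lambda>(r, c). of_bool (c = s r) - of_bool (t r = Some c))"

lemma diff_mat_carrier [simp]: "diff_mat N s t \<in> carrier_mat N N"
  by (simp add: diff_mat_def)

lemma diff_mat_integral: "elements_mat (diff_mat N s t) \<subseteq> \<int>"
  by (auto simp: diff_mat_def elements_mat_def)

lemma diff_mat_mult_vec:
  assumes v: "v \<in> carrier_vec N" and r: "r < N" "s r < N" and t: "\<And>c. t r = Some c \<Longrightarrow> c < N"
  shows "(diff_mat N s t *\<^sub>v v) $ r = v $ s r - (case t r of None \<Rightarrow> 0 | Some c \<Rightarrow> v $ c)"
proof -
  have "(diff_mat N s t *\<^sub>v v) $ r
      = (\<Sum>c = 0..<N. (of_bool (c = s r) - of_bool (t r = Some c)) * v $ c)"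
    using v r by (simp add: diff_mat_def scalar_prod_def)
  also have "\<dots> = (\<Sum>c = 0..<N. if c = s r then v $ c else 0)
      - (\<Sum>c = 0..<N. if t r = Some c then v $ c else 0)"
    unfolding sum_subtractf[symmetric] by (intro sum.cong) auto
  also have "(\<Sum>c = 0..<N. if c = s r then v $ c else 0) = v $ s r"
    using r by simp
  also have "(\<Sum>c = 0..<N. if t r = Some c then v $ c else 0)
      = (case t r of None \<Rightarrow> 0 | Some c \<Rightarrow> v $ c)"
    using t by (cases "t r") auto
  finally show ?thesis .
qed

text \<open>
  Both arrangements are indexed by the same set, so that \<open>f\<close> can be compared hyperplane by
  hyperplane.  The indexing may repeat hyperplanes: distinctness of the images comes from
  injectivity of \<open>f\<close> on points.
\<close>

lemma takes_arrangementI: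
  assumes f: "bij_betw f C C"
    and \<A>: "\<And>k. k \<in> K \<Longrightarrow> H k \<subseteq> C" and \<B>: "\<And>k. k \<in> K \<Longrightarrow> H' k \<subseteq> C"
    and iff: "\<And>k v. k \<in> K \<Longrightarrow> v \<in> C \<Longrightarrow> v \<in> H k \<longleftrightarrow> f v \<in> H' k"
  shows "takes_arrangement f (H ` K) (H' ` K)"
proof -
  have im: "f ` H k = H' k" if k: "k \<in> K" for k
  proof
    show "f ` H k \<subseteq> H' k" using \<A>[OF k] iff[OF k] by blast
    show "H' k \<subseteq> f ` H k"
    proof
      fix w assume w: "w \<in> H' k"
      then obtain v where "v \<in> C" "w = f v" using f \<B>[OF k] by (auto simp: bij_betw_def)
      then show "w \<in> f ` H k" using iff[OF k] w by blast
    qed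
  qed
  have "inj_on (image f) (H ` K)"
    by (rule inj_on_subset[OF inj_on_image_Pow[OF bij_betw_imp_inj_on[OF f]]]) (use \<A> in auto)
  moreover have "image f ` (H ` K) = H' ` K" using im by (auto simp: image_iff)
  ultimately show ?thesis by (simp add: takes_arrangement_def bij_betw_def)
qed

lemma bij_betw_invertible_Z_linear:
  assumes "invertible_Z_linear N f"
  shows "bij_betw f (carrier_vec N) (carrier_vec N)"
proof -
  obtain A B where A: "A \<in> carrier_mat N N" and B: "B \<in> carrier_mat N N"
    and f: "\<forall>v \<in> carrier_vec N. f v = A *\<^sub>v v" and AB: "A * B = 1\<^sub>m N" "B * A = 1\<^sub>m N"
    using assms by (auto simp: invertible_Z_linear_def)
  have 1: "B *\<^sub>v (A *\<^sub>v v) = v" "A *\<^sub>v (B *\<^sub>v v) = v" if "v \<in> carrier_vec N" for v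
    using that assoc_mult_mat_vec[OF A B that] assoc_mult_mat_vec[OF B A that] AB by auto
  show ?thesis
    by (rule bij_betw_byWitness[where f' = "\<lambda>v. B *\<^sub>v v"]) (use A B f 1 in auto)
qed

lemma order_isomorphic_intersection_poset:
  assumes f: "bij_betw f (carrier_vec N) (carrier_vec N)" and AB: "takes_arrangement f \<A> \<B>"
    and \<A>: "\<And>h. h \<in> \<A> \<Longrightarrow> h \<subseteq> carrier_vec N"
  shows "order_isomorphic (intersection_poset N \<A>) (\<lambda>U W. W \<subseteq> U)
           (intersection_poset N \<B>) (\<lambda>U W. W \<subseteq> U)"
proof -
  let ?C = "carrier_vec N :: real vec set"
  have inj: "inj_on f ?C" and ran: "f ` ?C = ?C" using f by (auto simp: bij_betw_def)
  have \<B>: "\<B> = image f ` \<A>" using AB by (auto simp: takes_arrangement_def bij_betw_def)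
  have im: "f ` (?C \<inter> \<Inter>\<F>) = ?C \<inter> \<Inter>(image f ` \<F>)" if "\<F> \<subseteq> \<A>" for \<F>
  proof -
    \<comment> \<open>Images commute only with nonempty intersections; with the whole space as a further
      member the empty family needs no separate treatment.\<close>
    have "f ` (\<Inter>h\<in>insert ?C \<F>. h) = (\<Inter>h\<in>insert ?C \<F>. f ` h)"
      by (rule image_INT[OF inj, of _ _ ?C]) (use that \<A> in auto)
    then show ?thesis using ran by simp
  qed
  have sub: "U \<subseteq> ?C" if "U \<in> intersection_poset N \<A>" for U
    using that by (auto simp: intersection_poset_def)
  have "inj_on (image f) (intersection_poset N \<A>)"
    by (rule inj_on_subset[OF inj_on_image_Pow[OF inj]]) (use sub in auto)
  moreover have "image f ` intersection_poset N \<A> = intersection_poset N \<B>"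
  proof
    show "image f ` intersection_poset N \<A> \<subseteq> intersection_poset N \<B>"
    proof clarify
      fix U assume "U \<in> intersection_poset N \<A>"
      then obtain \<F> where \<F>: "\<F> \<subseteq> \<A>" "U = ?C \<inter> \<Inter>\<F>" by (auto simp: intersection_poset_def)
      then have "f ` U = ?C \<inter> \<Inter>(image f ` \<F>)" "image f ` \<F> \<subseteq> \<B>" using im \<B> by auto
      then show "f ` U \<in> intersection_poset N \<B>" unfolding intersection_poset_def by blast
    qed
    show "intersection_poset N \<B> \<subseteq> image f ` intersection_poset N \<A>"
    proof
      fix U assume "U \<in> intersection_poset N \<B>"
      then obtain \<G> where "\<G> \<subseteq> image f ` \<A>" "U = ?C \<inter> \<Inter>\<G>"
        by (auto simp: intersection_poset_def \<B>)
      then obtain \<F> where \<F>: "\<F> \<subseteq> \<A>" "\<G> = image f ` \<F>" by (meson subset_imageE)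
      with \<open>U = _\<close> have "U = f ` (?C \<inter> \<Inter>\<F>)" using im by simp
      then show "U \<in> image f ` intersection_poset N \<A>"
        using \<F> by (auto simp: intersection_poset_def)
    qed
  qed
  moreover have "W \<subseteq> U \<longleftrightarrow> f ` W \<subseteq> f ` U"
    if "U \<in> intersection_poset N \<A>" "W \<in> intersection_poset N \<A>" for U W
    using inj_on_image_mem_iff[OF inj _ sub] sub that by blast
  ultimately show ?thesis
    unfolding order_isomorphic_def bij_betw_def by (intro exI[of _ "image f"]) simp
qed

section \<open>The intersection lattice of a graphic arrangement\<close>

text \<open>
  In a symmetric graph, connectedness of an induced subgraph is reachability by arcs inside the
  vertex set, so that inductions along paths become inductions on a transitive closure.
\<close>

lemma connected_induced_iff:
  assumes "sym (parcs G)"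
  shows "Digraph_Component.connected (with_proj G \<restriction> W) \<longleftrightarrow>
    W \<noteq> {} \<and> (\<forall>u \<in> W. \<forall>v \<in> W. (u, v) \<in> (Restr (parcs G) W)\<^sup>*)"
proof -
  let ?R = "Restr (parcs G) W"
  have R: "parcs (mk_symmetric (with_proj G \<restriction> W)) = ?R"
    using assms by (force simp: mk_symmetric_def sym_def)
  have "(u, v) \<in> rtrancl_on W ?R \<longleftrightarrow> (u, v) \<in> ?R\<^sup>*" if "u \<in> W" "v \<in> W" for u v
  proof
    assume "(u, v) \<in> rtrancl_on W ?R"
    then show "(u, v) \<in> ?R\<^sup>*" by (rule rtrancl_on_rtranclI)
  next
    assume "(u, v) \<in> ?R\<^sup>*"
    then show "(u, v) \<in> rtrancl_on W ?R"
      by (rule rtrancl_consistent_rtrancl_on) (use that in auto)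
  qed
  moreover have "pverts (mk_symmetric (with_proj G \<restriction> W)) = W" by (simp add: mk_symmetric_def)
  ultimately show ?thesis
    by (simp add: connected_def strongly_connected_def reachable_def R)
qed

definition block_flat :: "nat \<Rightarrow> ('a \<Rightarrow> nat) \<Rightarrow> 'a set set \<Rightarrow> real vec set" where
  "block_flat N p P = {v \<in> carrier_vec N. \<forall>W \<in> P. \<forall>a \<in> W. \<forall>b \<in> W. v $ p a = v $ p b}"

text \<open>
  If a block \<open>W\<close> of \<open>P\<close> meets a block \<open>Y\<close> of \<open>Q\<close>, the indicator vector of \<open>Y\<close> is constant on the
  blocks of \<open>Q\<close>; if it is also constant on \<open>W\<close>, then \<open>W\<close> lies inside \<open>Y\<close>.
\<close>

lemma block_flat_subset_iff:
  assumes p: "inj_on p V" "p ` V \<subseteq> {..<N}" and P: "partition_on V P" and Q: "partition_on V Q"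
  shows "block_flat N p Q \<subseteq> block_flat N p P \<longleftrightarrow> refines V P Q"
proof
  assume "refines V P Q"
  then show "block_flat N p Q \<subseteq> block_flat N p P"
    unfolding refines_def block_flat_def by blast
next
  assume sub: "block_flat N p Q \<subseteq> block_flat N p P"
  have "\<exists>Y \<in> Q. W \<subseteq> Y" if W: "W \<in> P" for W
  proof -
    obtain a where a: "a \<in> W" using partition_onD3[OF P] W by fastforce
    have WV: "W \<subseteq> V" and aV: "a \<in> V" using partition_onD1[OF P] W a by auto
    obtain Y where Y: "Y \<in> Q" "a \<in> Y" using partition_onD1[OF Q] aV by auto
    have YV: "Y \<subseteq> V" using partition_onD1[OF Q] Y by auto
    define v :: "real vec" where "v = vec N (\<lambda>k. of_bool (k \<in> p ` Y))"
    have v: "v $ p b = of_bool (b \<in> Y)" if "b \<in> V" for b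
    proof -
      have "p b \<in> p ` Y \<longleftrightarrow> b \<in> Y" using inj_on_image_mem_iff[OF p(1) that YV] .
      then show ?thesis using p(2) that by (auto simp: v_def)
    qed
    have "v $ p b = v $ p c" if "X \<in> Q" "b \<in> X" "c \<in> X" for X b c
    proof -
      have "b \<in> Y \<longleftrightarrow> c \<in> Y"
        using partition_onD2[OF Q] that Y by (auto simp: disjoint_def)
      moreover have "b \<in> V" "c \<in> V" using partition_onD1[OF Q] that by auto
      ultimately show ?thesis by (simp add: v)
    qed
    moreover have "v \<in> carrier_vec N" by (simp add: v_def)
    ultimately have "v \<in> block_flat N p Q" unfolding block_flat_def by blast
    then have "v \<in> block_flat N p P" using sub by blast
    then have eq: "v $ p b = v $ p a" if "b \<in> W" for b
      using W a that unfolding block_flat_def by blast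
    have "b \<in> Y" if "b \<in> W" for b
      using eq[OF that] v[OF aV] v[of b] that WV Y(2) by (simp add: subsetD split: if_splits)
    then show ?thesis using Y(1) by blast
  qed
  then show "refines V P Q" using P Q by (simp add: refines_def)
qed

definition tie :: "nat \<Rightarrow> ('a \<Rightarrow> nat) \<Rightarrow> 'a \<Rightarrow> 'a \<Rightarrow> real vec set" where
  "tie N p a b = {v \<in> carrier_vec N. v $ p a - v $ p b = 0}"

text \<open>
  Vertices of a connected block are joined by a path inside the block, along which the edge
  equations force equality.  Hence the subspace of a bond is an intersection of hyperplanes of
  the arrangement.
\<close>

lemma block_flat_bond:
  assumes "sym (parcs G)" and P: "P \<in> bond_lattice G"
  shows "block_flat N p P =
    carrier_vec N \<inter> \<Inter>{tie N p a b | a b. \<exists>W \<in> P. (a, b) \<in> Restr (parcs G) W}" (is "_ = ?R")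
proof
  show "block_flat N p P \<subseteq> ?R" by (auto simp: block_flat_def tie_def)
  show "?R \<subseteq> block_flat N p P"
  proof
    fix v assume v: "v \<in> ?R"
    have "v $ p a = v $ p b" if W: "W \<in> P" "a \<in> W" "b \<in> W" for W a b
    proof -
      have "(a, b) \<in> (Restr (parcs G) W)\<^sup>*"
        using P W connected_induced_iff[OF assms(1)] by (auto simp: bond_lattice_def)
      then show ?thesis
      proof induction
        case (step b c)
        have "v \<in> tie N p b c" using v W(1) step(2) by blast
        then show ?case using step(3) by (simp add: tie_def)
      qed simp
    qed
    moreover have "v \<in> carrier_vec N" using v by blast
    ultimately show "v \<in> block_flat N p P" unfolding block_flat_def by blast
  qed
qed

text \<open>
  The partition is that into the components of the graph with edge set \<open>E\<close>; its blocks are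
  connected in \<open>G\<close> because paths in \<open>E\<close> stay inside their component and \<open>E\<close> consists of arcs of \<open>G\<close>.
\<close>

lemma flat_eq_block_flat:
  assumes G: "sym (parcs G)" "parcs G \<subseteq> pverts G \<times> pverts G" and E: "E \<subseteq> parcs G" "sym E"
  shows "\<exists>P \<in> bond_lattice G.
    carrier_vec N \<inter> \<Inter>{tie N p a b | a b. (a, b) \<in> E} = block_flat N p P"
proof -
  define V where "V = pverts G"
  \<comment> \<open>The reflexive closure relates every element of the type to itself, hence the restriction.\<close>
  define r where "r = Restr (E\<^sup>*) V"
  have r: "equiv V r"
  proof (rule equivI)
    have "sym (E\<^sup>*)" using E(2) by (rule sym_rtrancl)
    then show "sym r" by (auto simp: r_def sym_def)
    show "trans r" by (auto simp: r_def trans_def)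
  qed (auto simp: r_def refl_on_def)
  have P: "partition_on V (V // r)" using r by (rule partition_on_quotient)
  have EV: "E \<subseteq> V \<times> V" using E G by (auto simp: V_def)
  have block: "(u, w) \<in> (Restr (parcs G) W)\<^sup>*" if W: "W \<in> V // r" and u: "u \<in> W" and w: "w \<in> W" for W u w
  proof -
    have "(u, w) \<in> r" using quotient_eq_iff[OF r W W u w] by simp
    then have "(u, w) \<in> E\<^sup>*" by (simp add: r_def)
    then have "w \<in> W \<and> (u, w) \<in> (Restr (parcs G) W)\<^sup>*"
    proof induction
      case base
      then show ?case using u by simp
    next
      case (step x y)
      have "(x, y) \<in> r" using step(2) EV by (auto simp: r_def)
      then have "y \<in> W" using in_quotient_imp_closed[OF r W] step(3) by blast
      then show ?case using step E(1) by (auto intro: rtrancl_into_rtrancl)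
    qed
    then show ?thesis by simp
  qed
  have bond: "V // r \<in> bond_lattice G"
    using P block partition_onD3[OF P]
    by (auto simp: bond_lattice_def connected_induced_iff[OF G(1)] V_def)
  have "carrier_vec N \<inter> \<Inter>{tie N p a b | a b. (a, b) \<in> E} = block_flat N p (V // r)" (is "?L = _")
  proof
    show "?L \<subseteq> block_flat N p (V // r)"
    proof
      fix v assume v: "v \<in> ?L"
      have "v $ p a = v $ p b" if "W \<in> V // r" "a \<in> W" "b \<in> W" for W a b
      proof -
        have "(a, b) \<in> r" using quotient_eq_iff[OF r that(1,1,2,3)] by simp
        then have "(a, b) \<in> E\<^sup>*" by (simp add: r_def)
        then show ?thesis
        proof induction
          case (step b c)
          have "v \<in> tie N p b c" using v step(2) by blast
          then show ?case using step(3) by (simp add: tie_def)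
        qed simp
      qed
      moreover have "v \<in> carrier_vec N" using v by blast
      ultimately show "v \<in> block_flat N p (V // r)" unfolding block_flat_def by blast
    qed
    show "block_flat N p (V // r) \<subseteq> ?L"
    proof
      fix v assume v: "v \<in> block_flat N p (V // r)"
      have "v \<in> tie N p a b" if ab: "(a, b) \<in> E" for a b
      proof -
        have "(a, b) \<in> r" "a \<in> V" using ab EV by (auto simp: r_def)
        then have "r `` {a} \<in> V // r" "a \<in> r `` {a}" "b \<in> r `` {a}"
          using equiv_class_self[OF r] by (auto intro: quotientI)
        then have "v $ p a = v $ p b" "v \<in> carrier_vec N" using v unfolding block_flat_def by blast+
        then show ?thesis by (simp add: tie_def)
      qed
      moreover have "v \<in> carrier_vec N" using v by (simp add: block_flat_def)
      ultimately show "v \<in> ?L" by blast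
    qed
  qed
  then show ?thesis using bond by blast
qed

text \<open>
  The numbering need not exhaust the coordinates: an unused coordinate is unconstrained in every
  flat.  This absorbs the isolated vertex of the larger graph.
\<close>

lemma bond_lattice_iso_intersection_poset:
  assumes G: "pair_graph G" and p: "inj_on p (pverts G)" "p ` pverts G \<subseteq> {..<N}"
  shows "order_isomorphic (bond_lattice G) (refines (pverts G))
    (intersection_poset N {tie N p a b | a b. (a, b) \<in> parcs G}) (\<lambda>U W. W \<subseteq> U)"
proof -
  let ?\<A> = "{tie N p a b | a b. (a, b) \<in> parcs G}"
  interpret pair_graph G by fact
  have sym: "sym (parcs G)"
    using pair_sym_arcs by (simp add: symmetric_def)
  have VV: "parcs G \<subseteq> pverts G \<times> pverts G"
    using in_arcsD1 in_arcsD2 by auto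
  have part: "partition_on (pverts G) P" if "P \<in> bond_lattice G" for P
    using that by (simp add: bond_lattice_def)
  note iff = block_flat_subset_iff[OF p part part]
  have "inj_on (block_flat N p) (bond_lattice G)"
  proof (rule inj_onI)
    fix P Q assume "P \<in> bond_lattice G" "Q \<in> bond_lattice G" "block_flat N p P = block_flat N p Q"
    then show "P = Q" using iff[of P Q] iff[of Q P] by (intro refines_asym) auto
  qed
  moreover have "block_flat N p ` bond_lattice G = intersection_poset N ?\<A>"
  proof
    show "block_flat N p ` bond_lattice G \<subseteq> intersection_poset N ?\<A>"
    proof (rule image_subsetI)
      fix P assume P: "P \<in> bond_lattice G"
      have "{tie N p a b | a b. \<exists>W \<in> P. (a, b) \<in> Restr (parcs G) W} \<subseteq> ?\<A>" by blast
      then show "block_flat N p P \<in> intersection_poset N ?\<A>"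
        unfolding block_flat_bond[OF sym P] intersection_poset_def by blast
    qed
    show "intersection_poset N ?\<A> \<subseteq> block_flat N p ` bond_lattice G"
    proof
      fix U assume "U \<in> intersection_poset N ?\<A>"
      then obtain \<F> where \<F>: "\<F> \<subseteq> ?\<A>" and U: "U = carrier_vec N \<inter> \<Inter>\<F>"
        by (auto simp: intersection_poset_def)
      \<comment> \<open>Both arcs of an edge define the same hyperplane, so this choice is symmetric.\<close>
      define E where "E = {(a, b) \<in> parcs G. tie N p a b \<in> \<F>}"
      have "tie N p a b = tie N p b a" for a b by (auto simp: tie_def)
      then have "sym E" using sym by (auto simp: E_def sym_def)
      moreover have "E \<subseteq> parcs G" by (auto simp: E_def)
      moreover have "\<F> = {tie N p a b | a b. (a, b) \<in> E}" using \<F> unfolding E_def by blast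
      ultimately show "U \<in> block_flat N p ` bond_lattice G"
        using flat_eq_block_flat[OF sym VV, of E N p] U by auto
    qed
  qed
  ultimately show ?thesis
    unfolding order_isomorphic_def bij_betw_def using iff by blast
qed

section \<open>The change of coordinates\<close>

text \<open>
  The vertex that receives \<open>x\<^sub>i\<close> as its coordinate.
\<close>

fun x_vertex :: "nat \<Rightarrow> vertex option" where
  "x_vertex i = (if i = 1 then None else Some (Even (2 * (i - 1))))"

text \<open>
  The coordinate of a vertex \<open>a\<close> is \<open>vertex_plus a\<close> minus \<open>vertex_minus a\<close> (if present), and the
  coordinate \<open>c\<close> is recovered as \<open>coord_plus c\<close> minus \<open>coord_minus c\<close>.
\<close>

fun vertex_plus :: "vertex option \<Rightarrow> coord" where
  "vertex_plus None = X 1"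
| "vertex_plus (Some (Even b)) = X (b div 2 + 1)"
| "vertex_plus (Some (Odd a l)) = X ((a + 1) div 2)"

fun vertex_minus :: "vertex option \<Rightarrow> coord option" where
  "vertex_minus (Some (Odd a l)) = Some (Y ((a + 1) div 2) l)"
| "vertex_minus _ = None"

fun coord_plus :: "coord \<Rightarrow> vertex option" where
  "coord_plus (X i) = x_vertex i"
| "coord_plus (Y i l) = x_vertex i"

fun coord_minus :: "coord \<Rightarrow> vertex option option" where
  "coord_minus (X i) = None"
| "coord_minus (Y i l) = Some (Some (Odd (2 * i - 1) l))"

lemma diff_mat_relabel:
  assumes p: "bij_betw p V {..<N}" and q: "bij_betw q C {..<N}"
    and v: "v \<in> carrier_vec N" and a: "a \<in> V" "s a \<in> C" "\<And>c. t a = Some c \<Longrightarrow> c \<in> C"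
  shows "(diff_mat N (q \<circ> s \<circ> inv_into V p) (map_option q \<circ> t \<circ> inv_into V p) *\<^sub>v v) $ p a
    = v $ q (s a) - (case t a of None \<Rightarrow> 0 | Some c \<Rightarrow> v $ q c)"
proof -
  have [simp]: "inv_into V p (p a) = a" using p a(1) by (rule bij_betw_inv_into_left)
  have lt: "q c < N" if "c \<in> C" for c using q that by (auto simp: bij_betw_def)
  have "p a < N" using p a(1) by (auto simp: bij_betw_def)
  then show ?thesis
    by (subst diff_mat_mult_vec[OF v]) (use a lt in \<open>auto split: option.splits\<close>)
qed

lemma pverts_adjoin_G_nu:
  "pverts (adjoin_isolated_vertex (G_nu n \<nu>)) =
     {None} \<union> {Some (Even (2 * j)) | j. 1 \<le> j \<and> j \<le> n}
     \<union> {Some (Odd (2 * i - 1) l) | i l. 1 \<le> i \<and> i \<le> n \<and> 1 \<le> l \<and> l \<le> \<nu> i}"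
proof -
  have "Some ` {Odd (2 * i - 1) l | i l. 1 \<le> i \<and> i \<le> n \<and> 1 \<le> l \<and> l \<le> \<nu> i}
      = {Some (Odd (2 * i - 1) l) | i l. 1 \<le> i \<and> i \<le> n \<and> 1 \<le> l \<and> l \<le> \<nu> i}"
    by blast
  moreover have "Some ` {Even (2 * j) | j. 1 \<le> j \<and> j \<le> n} = {Some (Even (2 * j)) | j. 1 \<le> j \<and> j \<le> n}"
    by blast
  moreover have "pverts (G_nu n \<nu>) = {Odd (2 * i - 1) l | i l. 1 \<le> i \<and> i \<le> n \<and> 1 \<le> l \<and> l \<le> \<nu> i}
      \<union> {Even (2 * j) | j. 1 \<le> j \<and> j \<le> n}"
    by (simp add: G_nu_def Let_def)
  ultimately show ?thesis
    unfolding adjoin_isolated_vertex_def by (simp only: image_Un pair_pre_digraph.simps) auto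
qed

text \<open>
  The third kind of new coordinate, \<open>x\<^sub>1\<close> at the isolated vertex, makes the map invertible.  No
  edge has that vertex as an end, and so its coordinate is left out of the conclusion.
\<close>

lemma exists_coordinate_change:
  assumes "weak_composition m n \<nu>"
  defines "N \<equiv> m + n + 1"
  defines "p \<equiv> vertex_pos m n \<nu>" and "q \<equiv> coord_pos n \<nu>"
  obtains f where "invertible_Z_linear N f"
    and "\<And>v i l. v \<in> carrier_vec N \<Longrightarrow> 1 \<le> i \<Longrightarrow> i \<le> n \<Longrightarrow> 1 \<le> l \<Longrightarrow> l \<le> \<nu> i \<Longrightarrow>
           f v $ p (Some (Odd (2 * i - 1) l)) = v $ q (X i) - v $ q (Y i l)"
    and "\<And>v j. v \<in> carrier_vec N \<Longrightarrow> 1 \<le> j \<Longrightarrow> j \<le> n \<Longrightarrow>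
           f v $ p (Some (Even (2 * j))) = v $ q (X (j + 1))"
proof -
  define V where "V = pverts (adjoin_isolated_vertex (G_nu n \<nu>))"
  define C where "C = coords n \<nu>"
  have p: "bij_betw p V {..<N}" unfolding p_def V_def N_def by (rule bij_vertex_pos[OF assms(1)])
  have q: "bij_betw q C {..<N}" unfolding q_def C_def N_def by (rule bij_coord_pos[OF assms(1)])
  define A where
    "A = diff_mat N (q \<circ> vertex_plus \<circ> inv_into V p) (map_option q \<circ> vertex_minus \<circ> inv_into V p)"
  define B where
    "B = diff_mat N (p \<circ> coord_plus \<circ> inv_into C q) (map_option p \<circ> coord_minus \<circ> inv_into C q)"
  have V1: "None \<in> V" and V2: "1 \<le> j \<Longrightarrow> j \<le> n \<Longrightarrow> Some (Even (2 * j)) \<in> V"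
    and V3: "1 \<le> i \<Longrightarrow> i \<le> n \<Longrightarrow> 1 \<le> l \<Longrightarrow> l \<le> \<nu> i \<Longrightarrow> Some (Odd (2 * i - 1) l) \<in> V" for i j l
    unfolding V_def pverts_adjoin_G_nu by blast+
  have Vx: "x_vertex i \<in> V" if "1 \<le> i" "i \<le> n + 1" for i
    using V1 V2[of "i - 1"] that by auto
  have C1: "1 \<le> i \<Longrightarrow> i \<le> n + 1 \<Longrightarrow> X i \<in> C"
    and C2: "1 \<le> i \<Longrightarrow> i \<le> n \<Longrightarrow> 1 \<le> l \<Longrightarrow> l \<le> \<nu> i \<Longrightarrow> Y i l \<in> C" for i l
    unfolding C_def coords_def by blast+
  have [simp]: "A \<in> carrier_mat N N" "B \<in> carrier_mat N N" by (simp_all add: A_def B_def)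
  have A_None: "(A *\<^sub>v v) $ p None = v $ q (X 1)" if "v \<in> carrier_vec N" for v
    unfolding A_def by (subst diff_mat_relabel[OF p q that]) (use V1 C1 in auto)
  have A_Even: "(A *\<^sub>v v) $ p (Some (Even (2 * j))) = v $ q (X (j + 1))"
    if "v \<in> carrier_vec N" "1 \<le> j" "j \<le> n" for v j
    unfolding A_def by (subst diff_mat_relabel[OF p q that(1)]) (use that V2 C1 in auto)
  have A_Odd: "(A *\<^sub>v v) $ p (Some (Odd (2 * i - 1) l)) = v $ q (X i) - v $ q (Y i l)"
    if "v \<in> carrier_vec N" "1 \<le> i" "i \<le> n" "1 \<le> l" "l \<le> \<nu> i" for v i l
    unfolding A_def by (subst diff_mat_relabel[OF p q that(1)]) (use that V3 C1 C2 in auto)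
  have A_x: "(A *\<^sub>v v) $ p (x_vertex i) = v $ q (X i)"
    if "v \<in> carrier_vec N" "1 \<le> i" "i \<le> n + 1" for v i
    using A_None[OF that(1)] A_Even[OF that(1), of "i - 1"] that by auto
  have B_X: "(B *\<^sub>v w) $ q (X i) = w $ p (x_vertex i)"
    if "w \<in> carrier_vec N" "1 \<le> i" "i \<le> n + 1" for w i
    unfolding B_def by (subst diff_mat_relabel[OF q p that(1)]) (use that Vx C1 in auto)
  have B_Y: "(B *\<^sub>v w) $ q (Y i l) = w $ p (x_vertex i) - w $ p (Some (Odd (2 * i - 1) l))"
    if "w \<in> carrier_vec N" "1 \<le> i" "i \<le> n" "1 \<le> l" "l \<le> \<nu> i" for w i l
    unfolding B_def by (subst diff_mat_relabel[OF q p that(1)]) (use that Vx V3 C2 in auto)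
  have "B *\<^sub>v (A *\<^sub>v v) = v" if v: "v \<in> carrier_vec N" for v
  proof (rule eq_vecI)
    have Av: "A *\<^sub>v v \<in> carrier_vec N" using v by (rule mult_mat_vec_carrier[rotated]) simp
    fix k assume "k < dim_vec v"
    then obtain c where c: "c \<in> C" "k = q c" using v q by (auto simp: bij_betw_def)
    show "(B *\<^sub>v (A *\<^sub>v v)) $ k = v $ k"
      using c v by (auto simp: C_def coords_def B_X B_Y A_x A_Odd Av simp del: x_vertex.simps One_nat_def)
  qed (use v in \<open>simp add: B_def diff_mat_def\<close>)
  moreover have "A *\<^sub>v (B *\<^sub>v w) = w" if w: "w \<in> carrier_vec N" for w
  proof (rule eq_vecI)
    have Bw: "B *\<^sub>v w \<in> carrier_vec N" using w by (rule mult_mat_vec_carrier[rotated]) simp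
    fix k assume "k < dim_vec w"
    then obtain a where a: "a \<in> V" "k = p a" using w p by (auto simp: bij_betw_def)
    consider "a = None" | j where "a = Some (Even (2 * j))" "1 \<le> j" "j \<le> n"
      | i l where "a = Some (Odd (2 * i - 1) l)" "1 \<le> i" "i \<le> n" "1 \<le> l" "l \<le> \<nu> i"
      using a(1) unfolding V_def pverts_adjoin_G_nu by blast
    then show "(A *\<^sub>v (B *\<^sub>v w)) $ k = w $ k"
    proof cases
      case 1
      then show ?thesis using a w A_None[OF Bw] B_X[OF w, of 1] by simp
    next
      case (2 j)
      then show ?thesis using a w A_Even[OF Bw, of j] B_X[OF w, of "j + 1"] by simp
    next
      case (3 i l)
      then show ?thesis using a w A_Odd[OF Bw, of i l] B_X[OF w, of i] B_Y[OF w, of i l] by simp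
    qed
  qed (use w in \<open>simp add: A_def diff_mat_def\<close>)
  ultimately have "invertible_Z_linear N (\<lambda>v. A *\<^sub>v v)"
    by (intro invertible_Z_linearI[where B = B]) (simp_all add: A_def B_def diff_mat_integral)
  then show thesis using A_Odd A_Even that by blast
qed

lemma graphic_arrangement_adjoin_G_nu:
  assumes "weak_composition m n \<nu>"
  shows "graphic_arrangement (vertex_pos m n \<nu>) (adjoin_isolated_vertex (G_nu n \<nu>)) =
    {tie (m + n + 1) (vertex_pos m n \<nu> \<circ> Some) a b | a b. (a, b) \<in> parcs (G_nu n \<nu>)}"
proof -
  have "{h a b | a b. (a, b) \<in> map_prod Some Some ` E} = {h (Some a) (Some b) | a b. (a, b) \<in> E}"
    for h :: "vertex option \<Rightarrow> vertex option \<Rightarrow> real vec set" and E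
    by auto
  then show ?thesis
    unfolding graphic_arrangement_def card_pverts_adjoin_G_nu[OF assms] tie_def
    by (simp add: adjoin_isolated_vertex_def)
qed

theorem theorem4p2:
  fixes m n :: nat and \<nu> :: "nat \<Rightarrow> nat"
  assumes "weak_composition m n \<nu>"
  shows "(\<exists>f. invertible_Z_linear (m + n + 1) f \<and>
            takes_arrangement f (homogenized_arrangement m n \<nu>)
              (graphic_arrangement (vertex_pos m n \<nu>) (adjoin_isolated_vertex (G_nu n \<nu>)))) \<and>
         order_isomorphic
           (intersection_poset (m + n + 1) (homogenized_arrangement m n \<nu>)) (\<lambda>U W. W \<subseteq> U)
           (bond_lattice (G_nu n \<nu>)) (refines (pverts (G_nu n \<nu>)))"
proof -
  let ?N = "m + n + 1" and ?p = "vertex_pos m n \<nu>" and ?q = "coord_pos n \<nu>"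
  let ?\<H> = "homogenized_arrangement m n \<nu>"
  let ?\<G> = "graphic_arrangement ?p (adjoin_isolated_vertex (G_nu n \<nu>))"
  obtain f where f: "invertible_Z_linear ?N f"
    and odd: "\<And>v i l. v \<in> carrier_vec ?N \<Longrightarrow> 1 \<le> i \<Longrightarrow> i \<le> n \<Longrightarrow> 1 \<le> l \<Longrightarrow> l \<le> \<nu> i \<Longrightarrow>
           f v $ ?p (Some (Odd (2 * i - 1) l)) = v $ ?q (X i) - v $ ?q (Y i l)"
    and even: "\<And>v j. v \<in> carrier_vec ?N \<Longrightarrow> 1 \<le> j \<Longrightarrow> j \<le> n \<Longrightarrow>
           f v $ ?p (Some (Even (2 * j))) = v $ ?q (X (j + 1))"
    using exists_coordinate_change[OF assms] by metis
  have bij: "bij_betw f (carrier_vec ?N) (carrier_vec ?N)"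
    using f by (rule bij_betw_invertible_Z_linear)
  \<comment> \<open>The index \<open>j\<close> is that of the vertex \<open>2j\<close>; the equation involves the \<open>x\<close> of index \<open>j + 1\<close>.\<close>
  define K where "K = {(i, j, l). 1 \<le> i \<and> i \<le> j \<and> j \<le> n \<and> 1 \<le> l \<and> l \<le> \<nu> i}"
  define H where "H = (\<lambda>(i, j, l). {v \<in> carrier_vec ?N.
    v $ ?q (X i) - v $ ?q (X (j + 1)) = v $ ?q (Y i l)} :: real vec set)"
  define H' where "H' = (\<lambda>(i, j, l).
    tie ?N (?p \<circ> Some) (Odd (2 * i - 1) l) (Even (2 * j)))"
  have \<H>: "?\<H> = H ` K"
  proof
    show "?\<H> \<subseteq> H ` K"
    proof
      fix h assume "h \<in> ?\<H>"
      then obtain i j l where ij: "1 \<le> i" "i < j" "j \<le> n + 1" "1 \<le> l" "l \<le> \<nu> i"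
        and h: "h = {v \<in> carrier_vec ?N. v $ ?q (X i) - v $ ?q (X j) = v $ ?q (Y i l)}"
        unfolding homogenized_arrangement_def by blast
      have "(i, j - 1, l) \<in> K" "h = H (i, j - 1, l)" using ij by (auto simp: K_def H_def h)
      then show "h \<in> H ` K" by blast
    qed
    show "H ` K \<subseteq> ?\<H>"
    proof clarify
      fix i j l assume "(i, j, l) \<in> K"
      then have "1 \<le> i \<and> i < j + 1 \<and> j + 1 \<le> n + 1 \<and> 1 \<le> l \<and> l \<le> \<nu> i" by (auto simp: K_def)
      then show "H (i, j, l) \<in> ?\<H>" unfolding H_def homogenized_arrangement_def by blast
    qed
  qed
  have \<G>: "?\<G> = H' ` K"
  proof -
    let ?t = "tie ?N (?p \<circ> Some)"
    define E where "E = (\<lambda>(i, j, l). (Odd (2 * i - 1) l, Even (2 * j))) ` K"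
    have "{(Odd (2 * i - 1) l, Even (2 * j)) | i j l.
        1 \<le> i \<and> i \<le> n \<and> 1 \<le> j \<and> j \<le> n \<and> 2 * i - 1 < 2 * j \<and> 1 \<le> l \<and> l \<le> \<nu> i}
      = {(Odd (2 * i - 1) l, Even (2 * j)) | i j l.
        1 \<le> i \<and> i \<le> j \<and> j \<le> n \<and> 1 \<le> l \<and> l \<le> \<nu> i}"
      by (rule Collect_cong, intro ex_cong1) linarith
    also have "\<dots> = E" unfolding E_def K_def by (auto simp: image_iff)
    finally have "parcs (G_nu n \<nu>) = E \<union> E\<inverse>" by (simp add: G_nu_def)
    moreover have "{?t a b | a b. (a, b) \<in> E \<union> E\<inverse>} = (\<lambda>(a, b). ?t a b) ` E"
    proof -
      have "?t a b = ?t b a" for a b by (auto simp: tie_def)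
      then have "?t a b \<in> (\<lambda>(a, b). ?t a b) ` E" if "(a, b) \<in> E \<union> E\<inverse>" for a b
        using that by (metis Un_iff case_prod_conv converseD image_eqI)
      then show ?thesis by auto
    qed
    moreover have "(\<lambda>(a, b). ?t a b) ` E = H' ` K"
      unfolding E_def H'_def image_image by (intro image_cong) auto
    ultimately show ?thesis unfolding graphic_arrangement_adjoin_G_nu[OF assms] by simp
  qed
  have takes: "takes_arrangement f ?\<H> ?\<G>"
    unfolding \<H> \<G>
  proof (rule takes_arrangementI[OF bij])
    fix k v assume k: "k \<in> K" and v: "v \<in> (carrier_vec ?N :: real vec set)"
    have fv: "f v \<in> carrier_vec ?N" using bij v by (auto simp: bij_betw_def)
    obtain i j l where "k = (i, j, l)" by (cases k)
    then show "v \<in> H k \<longleftrightarrow> f v \<in> H' k"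
      using k v fv odd[OF v, of i l] even[OF v, of j] by (auto simp: K_def H_def H'_def tie_def)
  qed (auto simp: H_def H'_def tie_def)
  have "order_isomorphic (intersection_poset ?N ?\<H>) (\<lambda>U W. W \<subseteq> U)
      (intersection_poset ?N ?\<G>) (\<lambda>U W. W \<subseteq> U)"
    by (rule order_isomorphic_intersection_poset[OF bij takes]) (auto simp: \<H> H_def)
  moreover have "order_isomorphic (intersection_poset ?N ?\<G>) (\<lambda>U W. W \<subseteq> U)
      (bond_lattice (G_nu n \<nu>)) (refines (pverts (G_nu n \<nu>)))"
  proof -
    have sub: "Some ` pverts (G_nu n \<nu>) \<subseteq> pverts (adjoin_isolated_vertex (G_nu n \<nu>))"
      by (auto simp: adjoin_isolated_vertex_def)
    have "inj_on (?p \<circ> Some) (pverts (G_nu n \<nu>))"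
      by (rule comp_inj_on) (use bij_vertex_pos[OF assms] sub in \<open>auto simp: bij_betw_def intro: inj_on_subset\<close>)
    moreover have "(?p \<circ> Some) ` pverts (G_nu n \<nu>) \<subseteq> {..<?N}"
      using bij_vertex_pos[OF assms] sub by (auto simp: bij_betw_def)
    ultimately show ?thesis
      unfolding graphic_arrangement_adjoin_G_nu[OF assms]
      by (rule order_isomorphic_sym[OF bond_lattice_iso_intersection_poset[OF pair_graph_G_nu]])
  qed
  ultimately show ?thesis using f takes order_isomorphic_trans by blast
qed

end
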